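(* $${}_2F_1\left(\tfrac13,\tfrac12;1;\tfrac15\right)=\frac{3}{20}\,\frac{2^{2/3}\,\sqrt5\,\Gamma(1/3)^3}{\pi^2}.$$
   Context: For complex $a,b,c$ with $c\notin\{0,-1,-2,\dots\}$ and $|x|<1$, ${}_2F_1(a,b;c;x)=\sum_{n\ge 0}\frac{(a,n)(b,n)}{(c,n)(1,n)}x^n$ denotes Gauss's hypergeometric series, where $(\alpha,n)=\alpha(\alpha+1)\cdots(\alpha+n-1)$, $(\alpha,0)=1$. *)

theory Defs
  imports "HOL-Analysis.Analysis"
begin

(* Meaningful for c not in {0, -1, -2, ...} and norm x < 1, where the series is well defined and
   converges; elsewhere the value carries no intended meaning. *)
definition hyp2F1 :: "complex \<Rightarrow> complex \<Rightarrow> complex \<Rightarrow> complex \<Rightarrow> complex" where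
  "hyp2F1 a b c x =
     (\<Sum>n. (pochhammer a n * pochhammer b n) / (pochhammer c n * pochhammer 1 n) * x ^ n)"

end

theory Submission
  imports Defs
begin

text \<open>
  Euler's integral turns the claim into the evaluation of
  \<open>I = \<integral> t^(-1/2) (1 - t)^(-1/2) (1 - t/5)^(-1/3) dt\<close> over \<open>[0, 1]\<close>. With \<open>t = 5 - 2 \<surd>5 exp (-3 s)\<close> the
  integrand becomes a multiple of \<open>exp (-s/2)\<close> times an even function of \<open>s\<close>, so only the even part
  \<open>cosh (s/2)\<close> survives, and in the variable \<open>D = 2 cosh s - 2\<close> what remains is a half period of the
  invariant differential on the elliptic curve \<open>y^2 = x^3 - (3x + \<alpha>)^2\<close>, where
  \<open>x = \<alpha> / D\<close> and \<open>\<alpha> = (9 \<surd>5 - 20) / 10\<close>. This curve has complex multiplication by the order of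
  discriminant -75, and a 5-isogeny defined over \<open>\<rat>(\<surd>5)\<close> maps it onto \<open>y^2 = u^3 - 625/4\<close>, where
  the integral is a Beta value: with \<open>r = 625 / (4 u^3)\<close> one gets \<open>\<surd>5 I = B(1/6, 1/2)\<close>.
\<close>

lemma pochhammer_mono:
  fixes a b :: real
  assumes "0 < a" "a \<le> b"
  shows "pochhammer a n \<le> pochhammer b n"
  using assms unfolding pochhammer_prod by (intro prod_mono) auto

lemma Beta_add_nat:
  fixes a b :: real
  assumes "0 < a" "0 < b"
  shows "Beta (a + real n) b = Beta a b * pochhammer a n / pochhammer (a + b) n"
proof (induction n)
  case (Suc n)
  have "(a + real n + b) * Beta (a + real n + 1) b = (a + real n) * Beta (a + real n) b"
    using assms by (intro Beta_plus1_left) (auto elim!: nonpos_Ints_cases)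
  then have "Beta (a + real (Suc n)) b = (a + real n) / (a + b + real n) * Beta (a + real n) b"
    using assms by (simp add: eq_divide_eq add_ac mult_ac)
  then show ?case
    unfolding pochhammer_Suc Suc.IH by (simp add: mult_ac)
qed simp

lemma Euler_integral_2F1:
  fixes a b c x :: real
  assumes a: "0 < a" "a \<le> 1" and bc: "0 < b" "b < c" and x: "0 \<le> x" "x < 1"
  defines "u \<equiv> (\<lambda>n. pochhammer a n * pochhammer b n / (pochhammer c n * pochhammer 1 n) * x ^ n)"
  shows "summable u"
    and "((\<lambda>t. t powr (b - 1) * (1 - t) powr (c - b - 1) * (1 - x * t) powr (- a))
           has_integral Beta b (c - b) * suminf u) {0..1}"
proof -
  have pos: "pochhammer a n > 0" "pochhammer b n > 0" "pochhammer c n > 0"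
    "pochhammer (1::real) n > 0" for n
    using a bc by (auto intro: pochhammer_pos)
  show summ: "summable u"
  proof (rule summable_comparison_test)
    show "summable (\<lambda>n. x ^ n)" using x by simp
    have "pochhammer a n * pochhammer b n / (pochhammer c n * pochhammer 1 n) \<le> 1" for n
    proof -
      have "pochhammer a n * pochhammer b n \<le> pochhammer 1 n * pochhammer c n"
        using a bc pos by (intro mult_mono pochhammer_mono) (auto intro: less_imp_le)
      then show ?thesis using pos[of n] by (simp add: mult_ac)
    qed
    then have "norm (u n) \<le> x ^ n" for n
      using x pos[of n] unfolding u_def
      by (simp add: abs_mult mult_left_le_one_le del: times_divide_eq_left)
    then show "\<exists>N. \<forall>n\<ge>N. norm (u n) \<le> x ^ n" by blast
  qed
  let ?w = "\<lambda>t::real. t powr (b - 1) * (1 - t) powr (c - b - 1)"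
  let ?k = "\<lambda>n. pochhammer a n / pochhammer 1 n * x ^ n"
  have summand: "((\<lambda>t. ?k n * (t ^ n * ?w t)) has_integral Beta b (c - b) * u n) {0..1}" for n
  proof -
    have "((\<lambda>t. t powr (b + real n - 1) * (1 - t) powr (c - b - 1)) has_integral
        Beta (b + real n) (c - b)) {0..1}"
      using bc by (intro has_integral_Beta_real) auto
    then have "((\<lambda>t. t ^ n * ?w t) has_integral Beta (b + real n) (c - b)) {0..1}"
    proof (rule has_integral_spike[of "{0}", rotated 2])
      show "t ^ n * ?w t = t powr (b + real n - 1) * (1 - t) powr (c - b - 1)"
        if "t \<in> {0..1} - {0}" for t
      proof -
        have "t powr (b + real n - 1) = t powr (real n + (b - 1))" by (simp add: algebra_simps)
        also have "\<dots> = t ^ n * t powr (b - 1)"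
          using that by (simp only: powr_add) (simp add: powr_realpow)
        finally show ?thesis by simp
      qed
    qed auto
    from has_integral_mult_right[OF this, of "?k n"] show ?thesis
      using Beta_add_nat[of b "c - b" n] bc by (simp add: u_def mult_ac)
  qed
  show "((\<lambda>t. ?w t * (1 - x * t) powr (- a)) has_integral Beta b (c - b) * suminf u) {0..1}"
  proof (rule has_integral_monotone_convergence_increasing)
    show "((\<lambda>t. \<Sum>n<k. ?k n * (t ^ n * ?w t)) has_integral (\<Sum>n<k. Beta b (c - b) * u n)) {0..1}" for k
      by (intro has_integral_sum summand) auto
    show "(\<Sum>n<k. ?k n * (t ^ n * ?w t)) \<le> (\<Sum>n<Suc k. ?k n * (t ^ n * ?w t))"
      if "t \<in> {0..1}" for k t
      using that x pos[of k] by simp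
    show "(\<lambda>k. \<Sum>n<k. ?k n * (t ^ n * ?w t)) \<longlonglongrightarrow> ?w t * (1 - x * t) powr (- a)"
      if t: "t \<in> {0..1}" for t
    proof -
      have "x * t \<le> x" using x t by (intro mult_right_le_one_le) auto
      then have "\<bar>- (x * t)\<bar> < 1" using x t by auto
      from gen_binomial_real[OF this, of "- a"]
      have "(\<lambda>n. ((- a) gchoose n) * (- (x * t)) ^ n) sums (1 - x * t) powr (- a)" by simp
      also have "(\<lambda>n. ((- a) gchoose n) * (- (x * t)) ^ n) = (\<lambda>n. ?k n * t ^ n)"
        by (simp add: fun_eq_iff gbinomial_pochhammer power_minus[of "x * _"] power_mult_distrib
            pochhammer_fact[symmetric] mult_ac flip: power_mult_distrib)
      finally have "(\<lambda>n. ?k n * t ^ n) sums (1 - x * t) powr (- a)" .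
      from sums_mult[OF this, of "?w t"] show ?thesis by (simp add: sums_def mult_ac)
    qed
    show "(\<lambda>k. \<Sum>n<k. Beta b (c - b) * u n) \<longlonglongrightarrow> Beta b (c - b) * suminf u"
      using summable_LIMSEQ[OF summ] unfolding sum_distrib_left[symmetric]
      by (intro tendsto_intros)
  qed
qed

lemma Gamma_third_two_thirds: "Gamma (1/3) * Gamma (2/3 :: real) = 2 * pi / sqrt 3"
proof -
  have "complex_of_real (Gamma (1/3) * Gamma (2/3)) = Gamma (of_real (1/3)) * Gamma (1 - of_real (1/3))"
    by (simp flip: Gamma_complex_of_real)
  also have "\<dots> = of_real (pi / sin (pi * (1/3)))"
    unfolding Gamma_reflection_complex by (simp flip: sin_of_real)
  finally show ?thesis unfolding of_real_eq_iff by (simp add: sin_60)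
qed

lemma Gamma_sixth: "Gamma (1/6) * Gamma (2/3 :: real) = 2 powr (2/3) * sqrt pi * Gamma (1/3)"
proof -
  have "complex_of_real (Gamma (1/6) * Gamma (2/3)) = Gamma (of_real (1/6)) * Gamma (of_real (1/6) + 1/2)"
    by (simp flip: Gamma_complex_of_real)
  also have "\<dots> = exp (of_real (2/3 * ln 2)) * of_real (sqrt pi) * Gamma (of_real (1/3))"
    by (subst Gamma_legendre_duplication) (auto elim!: nonpos_Ints_cases simp: complex_eq_iff)
  also have "\<dots> = complex_of_real (2 powr (2/3) * sqrt pi * Gamma (1/3))"
    unfolding exp_of_real Gamma_complex_of_real by (simp add: powr_def)
  finally show ?thesis unfolding of_real_eq_iff .
qed

lemma Beta_sixth_half: "Beta (1/6) (1/2 :: real) = 3/4 * 2 powr (2/3) * Gamma (1/3) ^ 3 / pi"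
proof -
  have pos: "Gamma (1/3 :: real) > 0" "Gamma (2/3 :: real) > 0" by (auto intro: Gamma_real_pos)
  have G: "Gamma (2/3 :: real) = 2 * pi / (sqrt 3 * Gamma (1/3))"
    using Gamma_third_two_thirds less_imp_neq[OF pos(1)] by (simp add: eq_divide_eq mult_ac)
  have "Beta (1/6) (1/2 :: real) = Gamma (1/6) * sqrt pi / Gamma (2/3)"
    by (simp add: Beta_def Gamma_one_half_real)
  also have "\<dots> = (Gamma (1/6) * Gamma (2/3)) * sqrt pi / (Gamma (2/3))\<^sup>2"
    using pos by (simp add: power2_eq_square)
  also have "\<dots> = 2 powr (2/3) * pi * Gamma (1/3) / (Gamma (2/3))\<^sup>2"
    unfolding Gamma_sixth by simp
  also have "\<dots> = 3/4 * 2 powr (2/3) * Gamma (1/3) ^ 3 / pi"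
    unfolding G using pos by (simp add: field_simps power2_eq_square power3_eq_cube)
  finally show ?thesis .
qed

text \<open>
  With \<open>D = \<alpha> / x\<close>, the 5-isogeny is \<open>u = iso_n D / (D (iso_h D)^2)\<close>, obtained from Velu's formulas;
  \<open>iso_h\<close> is the kernel polynomial. The factor \<open>iso_m\<close> is, up to scale, the numerator of \<open>-du/dD\<close>, and
  \<open>iso_t D\<close> is \<open>10 D^3 / \<alpha>^2\<close> times the cubic of the source curve at \<open>x\<close>. All polynomials are scaled
  to have coefficients in \<open>\<int>[\<surd>5]\<close>.
\<close>

definition iso_h :: "real \<Rightarrow> real" where
  "iso_h D = 5 - 3 * sqrt 5 + 20 * D + 8 * D ^ 2"

definition iso_n :: "real \<Rightarrow> real" where
  "iso_n D = 123 * sqrt 5 - 275 + (510 * sqrt 5 - 1150) * D + 600 * (sqrt 5 - 4) * D ^ 2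
     - 2800 * D ^ 3 - 800 * D ^ 4"

definition iso_m :: "real \<Rightarrow> real" where
  "iso_m D = 360 * sqrt 5 - 805 + (1845 * sqrt 5 - 4125) * D + 180 * (21 * sqrt 5 - 50) * D ^ 2
     + (2880 * sqrt 5 - 14200) * D ^ 3 + (1800 * sqrt 5 - 11400) * D ^ 4
     - 7200 * D ^ 5 - 1600 * D ^ 6"

definition iso_t :: "real \<Rightarrow> real" where
  "iso_t D = 9 * sqrt 5 - 20 - 90 * D - 60 * D ^ 2 - 10 * D ^ 3"

lemma sqrt5_reduce: "sqrt 5 * sqrt 5 = (5::real)" "sqrt 5 * (sqrt 5 * x) = 5 * x" for x :: real
  by auto

lemma sqrt5_bounds: "2236067 / 1000000 < sqrt (5::real)" "sqrt (5::real) < 2236068 / 1000000"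
  by (rule real_less_rsqrt, simp add: power2_eq_square)
     (rule real_less_lsqrt, simp_all add: power2_eq_square)

lemma iso_isogeny:
  "20 * iso_n D ^ 3 - 3125 * D ^ 3 * iso_h D ^ 6 = 32 * iso_t D * iso_m D ^ 2"
proof -
  let ?w = "sqrt (5::real)"
  have h3: "iso_h D ^ 3 = 800 - 360 * ?w + (4200 - 1800 * ?w) * D + (7680 - 4320 * ?w) * D ^ 2
      + (12800 - 2880 * ?w) * D ^ 3 + (10560 - 576 * ?w) * D ^ 4 + 3840 * D ^ 5 + 512 * D ^ 6"
    unfolding iso_h_def by (simp add: algebra_simps sqrt5_reduce eval_nat_numeral)
  have h6: "iso_h D ^ 6 = (iso_h D ^ 3) ^ 2" by simp
  show ?thesis unfolding h6 h3 iso_n_def iso_m_def iso_t_def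
    by (simp add: algebra_simps sqrt5_reduce eval_nat_numeral)
qed

lemma iso_differential:
  "4 * iso_m D = iso_n D * (iso_h D + 2 * D * (20 + 16 * D))
     - (510 * sqrt 5 - 1150 + 1200 * (sqrt 5 - 4) * D - 8400 * D ^ 2 - 3200 * D ^ 3) * D * iso_h D"
  unfolding iso_n_def iso_m_def iso_h_def
  by (simp add: algebra_simps sqrt5_reduce eval_nat_numeral)

lemma iso_signs:
  assumes "0 \<le> D" "0 \<le> iso_t D"
  shows "iso_h D < 0" "iso_m D < 0" "0 < iso_n D"
proof -
  have "0 \<le> D ^ 2" "0 \<le> D ^ 3" using assms by auto
  then have "90 * D \<le> 9 * sqrt 5 - 20" using assms(2) unfolding iso_t_def by linarith
  then have D: "D \<le> 1/700" using sqrt5_bounds by simp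
  have p: "D ^ 2 \<le> (1/700) ^ 2" "D ^ 3 \<le> (1/700) ^ 3" "D ^ 4 \<le> (1/700) ^ 4"
    using assms D by (auto intro!: power_mono simp del: power_one_over)
  show "iso_h D < 0" using D p sqrt5_bounds unfolding iso_h_def by (simp add: power_one_over)
  have "(510 * sqrt 5 - 1150) * D \<ge> -10 * (1/700)"
    using sqrt5_bounds D assms mult_mono[of "1150 - 510 * sqrt 5" 10 D "1/700"] by (simp add: algebra_simps)
  moreover have "600 * (sqrt 5 - 4) * D ^ 2 \<ge> -1200 * (1/700) ^ 2"
    using sqrt5_bounds p assms mult_mono[of "600 * (4 - sqrt 5)" 1200 "D ^ 2" "(1/700) ^ 2"] by (simp add: algebra_simps)
  ultimately show "0 < iso_n D" using p sqrt5_bounds unfolding iso_n_def by (simp add: power_one_over)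
  have "(1845 * sqrt 5 - 4125) * D \<le> 1 * (1/700)"
    using sqrt5_bounds D assms by (intro mult_mono) auto
  moreover have "180 * (21 * sqrt 5 - 50) * D ^ 2 \<le> 0" "(2880 * sqrt 5 - 14200) * D ^ 3 \<le> 0"
    "(1800 * sqrt 5 - 11400) * D ^ 4 \<le> 0"
    using sqrt5_bounds assms by (auto intro!: mult_nonpos_nonneg)
  moreover have "0 \<le> D ^ 5" "0 \<le> D ^ 6" using assms by auto
  ultimately show "iso_m D < 0" using sqrt5_bounds unfolding iso_m_def by linarith
qed

lemma iso_deriv:
  assumes "iso_n D \<noteq> 0"
  shows "((\<lambda>D. 625/4 * D ^ 3 * iso_h D ^ 6 / iso_n D ^ 3) has_real_derivative
           1875 * D ^ 2 * iso_h D ^ 5 * iso_m D / iso_n D ^ 4) (at D)"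
proof -
  let ?n' = "510 * sqrt 5 - 1150 + 1200 * (sqrt 5 - 4) * D - 8400 * D ^ 2 - 3200 * D ^ 3"
  have h: "(iso_h has_real_derivative 20 + 16 * D) (at D)"
    unfolding iso_h_def[abs_def] by (auto intro!: derivative_eq_intros)
  have n: "(iso_n has_real_derivative ?n') (at D)"
    unfolding iso_n_def[abs_def] by (auto intro!: derivative_eq_intros)
  let ?d = "625/4 * (3 * D ^ 2 * iso_h D ^ 6 + 6 * iso_h D ^ 5 * (20 + 16 * D) * D ^ 3) / iso_n D ^ 3
    - 625/4 * D ^ 3 * iso_h D ^ 6 * (3 * iso_n D ^ 2 * ?n') / (iso_n D ^ 3) ^ 2"
  have "((\<lambda>D. 625/4 * D ^ 3 * iso_h D ^ 6 / iso_n D ^ 3) has_real_derivative ?d) (at D)"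
    using assms by (auto intro!: derivative_eq_intros h n simp: field_simps eval_nat_numeral)
  also have "?d = 1875/4 * D ^ 2 * iso_h D ^ 5 * (4 * iso_m D) / iso_n D ^ 4"
    unfolding iso_differential using assms by (simp add: field_simps eval_nat_numeral)
  finally show ?thesis by (simp add: mult_ac)
qed

lemma has_integral_substitution_increasing:
  fixes f g g' :: "real \<Rightarrow> real"
  assumes ab: "a \<le> b" and f: "(f has_integral I) {g a..g b}"
    and nonneg: "\<And>t. t \<in> {g a..g b} \<Longrightarrow> 0 \<le> f t"
    and deriv: "\<And>x. x \<in> {a..b} \<Longrightarrow> (g has_real_derivative g' x) (at x)"
    and pos: "\<And>x. x \<in> {a<..<b} \<Longrightarrow> 0 < g' x"
  shows "((\<lambda>x. f (g x) * g' x) has_integral I) {a..b}"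
proof -
  have cont: "continuous_on {a..b} g"
    by (intro continuous_at_imp_continuous_on ballI DERIV_isCont[OF deriv])
  have less: "g x < g y" if "a \<le> x" "x < y" "y \<le> b" for x y
  proof (rule DERIV_pos_imp_increasing_open[OF \<open>x < y\<close>])
    show "continuous_on {x..y} g" using that by (intro continuous_on_subset[OF cont]) auto
    show "\<exists>y. (g has_real_derivative y) (at z) \<and> 0 < y" if "x < z" "z < y" for z
      using that \<open>a \<le> x\<close> \<open>y \<le> b\<close> by (intro exI[of _ "g' z"] conjI deriv pos) auto
  qed
  have inj: "inj_on g {a..b}"
  proof (rule inj_onI)
    fix x y assume "x \<in> {a..b}" "y \<in> {a..b}" "g x = g y"
    then show "x = y" using less[of x y] less[of y x] by (cases x y rule: linorder_cases) auto
  qed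
  have img: "g ` {a..b} = {g a..g b}"
  proof
    show "g ` {a..b} \<subseteq> {g a..g b}"
      using less by (auto simp: le_less)
    show "{g a..g b} \<subseteq> g ` {a..b}"
    proof
      fix y assume "y \<in> {g a..g b}"
      then obtain x where "a \<le> x" "x \<le> b" "g x = y" using IVT'[of g a y b] ab cont by auto
      then show "y \<in> g ` {a..b}" by auto
    qed
  qed
  have "f absolutely_integrable_on {g a..g b}"
    using f nonneg by (intro nonnegative_absolutely_integrable_1) auto
  with f have "f absolutely_integrable_on (g ` {a..b}) \<and> integral (g ` {a..b}) f = I"
    unfolding img by (auto simp: integral_unique)
  then have "(\<lambda>x. \<bar>g' x\<bar> * f (g x)) absolutely_integrable_on {a..b} \<and>
      integral {a..b} (\<lambda>x. \<bar>g' x\<bar> * f (g x)) = I"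
    by (subst has_absolute_integral_change_of_variables_1'[of _ g])
       (auto intro: inj has_field_derivative_at_within[OF deriv])
  then have "((\<lambda>x. \<bar>g' x\<bar> * f (g x)) has_integral I) {a..b}"
    by (metis has_integral_integral set_lebesgue_integral_eq_integral(1))
  then show ?thesis
  proof (rule has_integral_spike[of "{a, b}", rotated 2])
    show "f (g x) * g' x = \<bar>g' x\<bar> * f (g x)" if "x \<in> {a..b} - {a, b}" for x
      using pos[of x] that by auto
  qed auto
qed

definition endpoint :: real where
  "endpoint = ln (sqrt 5 / 2) / 3"

definition radicand :: "real \<Rightarrow> real" where
  "radicand s = 9 / 10 * sqrt 5 - exp (3 * s) - exp (- (3 * s))"

definition dcosh :: "real \<Rightarrow> real" where
  "dcosh s = exp s + exp (- s) - 2"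

lemma endpoint_pos: "0 < endpoint"
  using sqrt5_bounds unfolding endpoint_def by simp

lemma exp_3_endpoint:
  "exp (3 * endpoint) = sqrt 5 / 2" "exp (- (3 * endpoint)) = 2/5 * sqrt 5"
proof -
  show *: "exp (3 * endpoint) = sqrt 5 / 2" unfolding endpoint_def by simp
  show "exp (- (3 * endpoint)) = 2/5 * sqrt 5" unfolding exp_minus * by (simp add: field_simps)
qed

lemma radicand_factor:
  "radicand s = (sqrt 5 / 2 - exp (3 * s)) * (1 - 2/5 * sqrt 5 * exp (- (3 * s)))"
proof -
  have "exp (3 * s) * exp (- (3 * s)) = 1" by (simp add: exp_minus)
  then show ?thesis unfolding radicand_def by (simp add: field_simps sqrt5_reduce)
qed

lemma radicand_endpoint: "radicand endpoint = 0"
  by (simp add: radicand_factor exp_3_endpoint)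

lemma radicand_pos:
  assumes "- endpoint < s" "s < endpoint"
  shows "0 < radicand s"
proof -
  have "exp (3 * s) < sqrt 5 / 2" "exp (- (3 * s)) < sqrt 5 / 2"
    using assms unfolding exp_3_endpoint(1)[symmetric] by auto
  moreover from this(2) have "2/5 * sqrt 5 * exp (- (3 * s)) < 2/5 * sqrt 5 * (sqrt 5 / 2)"
    by (intro mult_strict_left_mono) auto
  ultimately show ?thesis unfolding radicand_factor by (intro mult_pos_pos) auto
qed

lemma radicand_nonneg:
  assumes "- endpoint \<le> s" "s \<le> endpoint"
  shows "0 \<le> radicand s"
proof -
  have "exp (3 * s) \<le> sqrt 5 / 2" "exp (- (3 * s)) \<le> sqrt 5 / 2"
    using assms unfolding exp_3_endpoint(1)[symmetric] by auto
  moreover from this(2) have "2/5 * sqrt 5 * exp (- (3 * s)) \<le> 2/5 * sqrt 5 * (sqrt 5 / 2)"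
    by (intro mult_left_mono) auto
  ultimately show ?thesis unfolding radicand_factor by (intro mult_nonneg_nonneg) auto
qed

lemma iso_t_dcosh: "iso_t (dcosh s) = 10 * radicand s"
proof -
  define x y where "x = exp s" and "y = exp (- s)"
  have xy: "x * y = 1" by (simp add: x_def y_def exp_minus)
  have "exp (3 * s) = x ^ 3" "exp (- (3 * s)) = y ^ 3"
    by (simp_all add: x_def y_def flip: exp_of_nat_mult)
  moreover have "(x + y - 2) ^ 3 + 6 * (x + y - 2) ^ 2 + 9 * (x + y - 2) + 2
      = x ^ 3 + y ^ 3 + 3 * (x * y - 1) * (x + y)"
    by (simp add: algebra_simps eval_nat_numeral)
  ultimately show ?thesis
    unfolding iso_t_def dcosh_def radicand_def x_def[symmetric] y_def[symmetric] xy by simp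
qed

lemma dcosh_eq_square: "dcosh s = (exp (s / 2) - exp (- (s / 2))) ^ 2"
proof -
  have "exp (s / 2) ^ 2 = exp s" "exp (- (s / 2)) ^ 2 = exp (- s)"
    by (simp_all flip: exp_of_nat_mult)
  moreover have "exp (s / 2) * exp (- (s / 2)) = 1" by (simp flip: exp_add)
  ultimately show ?thesis unfolding dcosh_def power2_diff by simp
qed

lemma has_integral_log_substitution:
  assumes "((\<lambda>t. t powr (-1/2) * (1 - t) powr (-1/2) * (1 - t / 5) powr (-1/3)) has_integral I) {0..1}"
  shows "((\<lambda>s. 3 * exp endpoint * (exp (- (s / 2)) / sqrt (radicand s))) has_integral I)
           {- endpoint..endpoint}"
proof -
  let ?L = endpoint
  let ?f = "\<lambda>t::real. t powr (-1/2) * (1 - t) powr (-1/2) * (1 - t / 5) powr (-1/3)"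
  let ?g = "\<lambda>s. 5 - 2 * sqrt 5 * exp (- (3 * s))"
  let ?g' = "\<lambda>s. 6 * sqrt 5 * exp (- (3 * s))"
  have ends: "?g (- ?L) = 0" "?g ?L = 1" by (simp_all add: exp_3_endpoint)
  have "((\<lambda>s. ?f (?g s) * ?g' s) has_integral I) {- ?L..?L}"
  proof (rule has_integral_substitution_increasing[where f = ?f and g = ?g and g' = ?g'])
    show "(?f has_integral I) {?g (- ?L)..?g ?L}" unfolding ends by fact
    show "(?g has_real_derivative ?g' s) (at s)" for s by (auto intro!: derivative_eq_intros)
  qed (use endpoint_pos in auto)
  then show ?thesis
  proof (rule has_integral_spike[of "{- ?L, ?L}", rotated 2])
    fix s assume "s \<in> {- ?L..?L} - {- ?L, ?L}"
    then have s: "- ?L < s" "s < ?L" by auto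
    define X where "X = exp (- (3 * s))"
    have X: "X > 0" by (simp add: X_def)
    have T: "radicand s > 0" using radicand_pos s by blast
    have "X < sqrt 5 / 2" "2/5 * sqrt 5 < X"
      using s unfolding exp_3_endpoint[symmetric] X_def by auto
    then have "2 * sqrt 5 * X < 2 * sqrt 5 * (sqrt 5 / 2)" "2 * sqrt 5 * (2/5 * sqrt 5) < 2 * sqrt 5 * X"
      by (intro mult_strict_left_mono; simp)+
    then have g: "0 < ?g s" "?g s < 1" unfolding X_def[symmetric] by auto
    have "?g s * (1 - ?g s) = 20 * (9 / 10 * sqrt 5 - exp (3 * s) - X) * X"
    proof -
      have "exp (3 * s) * X = 1" by (simp add: X_def exp_minus)
      then show ?thesis unfolding X_def[symmetric] by (simp add: algebra_simps)
    qed
    also have "\<dots> = 20 * radicand s * X" by (simp add: radicand_def X_def)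
    finally have prod: "?g s * (1 - ?g s) = 20 * radicand s * X" .
    have "?g s powr (-1/2) * (1 - ?g s) powr (-1/2) = (?g s * (1 - ?g s)) powr (-1/2)"
      using g by (simp only: powr_mult)
    also have "\<dots> = inverse (sqrt (20 * radicand s * X))"
      unfolding prod using X T by (simp add: powr_minus powr_half_sqrt)
    also have "sqrt (20 * radicand s * X) = 2 * sqrt 5 * sqrt (radicand s) * exp (- (3 * s) / 2)"
    proof -
      have "sqrt X = exp (- (3 * s) / 2)" unfolding X_def
        by (rule real_sqrt_unique) (simp_all flip: exp_of_nat_mult)
      moreover have "sqrt (20::real) = 2 * sqrt 5"
        by (rule real_sqrt_unique) (simp_all add: power_mult_distrib)
      ultimately show ?thesis by (simp add: real_sqrt_mult)
    qed
    finally have 1: "?g s powr (-1/2) * (1 - ?g s) powr (-1/2)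
      = inverse (2 * sqrt 5 * sqrt (radicand s) * exp (- (3 * s) / 2))" .
    have "1 - ?g s / 5 = exp (- (3 * ?L)) * exp (- (3 * s))"
      unfolding exp_3_endpoint by (simp add: field_simps)
    also have "\<dots> = exp (- (3 * (?L + s)))" by (simp add: algebra_simps flip: exp_add)
    finally have "1 - ?g s / 5 = exp (- (3 * (?L + s)))" .
    then have 2: "(1 - ?g s / 5) powr (-1/3) = exp (?L + s)"
      by (simp only: powr_def) (simp add: field_simps)
    have "exp (- (3 * s)) = exp (- (3 * s) / 2) * exp (- (3 * s) / 2)" by (simp flip: exp_add)
    then have "?f (?g s) * ?g' s = 3 * exp (?L + s) * exp (- (3 * s) / 2) / sqrt (radicand s)"
      unfolding 1 2 using T by (simp add: field_simps)
    also have "exp (?L + s) * exp (- (3 * s) / 2) = exp ?L * exp (- (s / 2))"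
      by (simp flip: exp_add)
    ultimately show "3 * exp ?L * (exp (- (s / 2)) / sqrt (radicand s)) = ?f (?g s) * ?g' s"
      by (simp add: mult_ac)
  qed auto
qed

lemma has_integral_fold_even:
  assumes "((\<lambda>s. c * (exp (- (s / 2)) / sqrt (radicand s))) has_integral I) {- a..a}" "0 \<le> a"
  shows "((\<lambda>s. c * ((exp (s / 2) + exp (- (s / 2))) / sqrt (radicand s))) has_integral I) {0..a}"
proof -
  let ?\<phi> = "\<lambda>s. c * (exp (- (s / 2)) / sqrt (radicand s))"
  have int: "?\<phi> integrable_on {- a..a}" using assms by blast
  then have "?\<phi> integrable_on {- a..0}" "?\<phi> integrable_on {0..a}"
    using assms(2) by (auto intro: integrable_on_subinterval)
  then have 1: "(?\<phi> has_integral integral {- a..0} ?\<phi>) {- a..0}"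
    and 2: "(?\<phi> has_integral integral {0..a} ?\<phi>) {0..a}" by blast+
  have "integral {- a..0} ?\<phi> + integral {0..a} ?\<phi> = I"
    using Henstock_Kurzweil_Integration.integral_combine[OF _ _ int, of 0] assms(2)
      integral_unique[OF assms(1)] by linarith
  moreover have "((\<lambda>s. ?\<phi> (- s)) has_integral integral {- a..0} ?\<phi>) {0..a}"
    using 1 has_integral_reflect_real[of ?\<phi> _ 0 "- a"] by simp
  ultimately have "((\<lambda>s. ?\<phi> (- s) + ?\<phi> s) has_integral I) {0..a}"
    using has_integral_add[OF _ 2, of "\<lambda>s. ?\<phi> (- s)" "integral {- a..0} ?\<phi>"] by simp
  moreover have "?\<phi> (- s) + ?\<phi> s = c * ((exp (s / 2) + exp (- (s / 2))) / sqrt (radicand s))" for s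
  proof -
    have "radicand (- s) = radicand s" by (simp add: radicand_def)
    then show ?thesis by (simp add: add_divide_distrib distrib_left)
  qed
  ultimately show ?thesis by simp
qed

lemma has_integral_isogeny_substitution:
  "((\<lambda>s. sqrt 5 * (3 * exp endpoint * ((exp (s / 2) + exp (- (s / 2))) / sqrt (radicand s))))
     has_integral Beta (1/6) (1/2)) {0..endpoint}"
proof -
  let ?L = endpoint
  let ?f = "\<lambda>r::real. r powr (1/6 - 1) * (1 - r) powr (1/2 - 1)"
  define R where "R = (\<lambda>D. 625/4 * D ^ 3 * iso_h D ^ 6 / iso_n D ^ 3)"
  define R' where "R' = (\<lambda>D. 1875 * D ^ 2 * iso_h D ^ 5 * iso_m D / iso_n D ^ 4)"
  let ?g = "\<lambda>s. R (dcosh s)"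
  let ?g' = "\<lambda>s. R' (dcosh s) * (exp s - exp (- s))"
  have dcosh_nonneg: "0 \<le> dcosh s" for s unfolding dcosh_eq_square by simp
  have signs: "iso_h (dcosh s) < 0" "iso_m (dcosh s) < 0" "0 < iso_n (dcosh s)"
    if "0 \<le> s" "s \<le> ?L" for s
    using iso_signs[OF dcosh_nonneg, of s] radicand_nonneg[of s] that endpoint_pos
    by (auto simp: iso_t_dcosh)
  have one_minus_R: "1 - R (dcosh s) = 16 * radicand s * iso_m (dcosh s) ^ 2 / iso_n (dcosh s) ^ 3"
    if "0 \<le> s" "s \<le> ?L" for s
  proof -
    have "1 - R (dcosh s)
        = (20 * iso_n (dcosh s) ^ 3 - 3125 * dcosh s ^ 3 * iso_h (dcosh s) ^ 6) / (20 * iso_n (dcosh s) ^ 3)"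
      using signs(3)[OF that] unfolding R_def by (simp add: diff_divide_distrib)
    then show ?thesis unfolding iso_isogeny iso_t_dcosh by simp
  qed
  have ends: "?g 0 = 0" "?g ?L = 1"
    using one_minus_R[of ?L] endpoint_pos by (auto simp: R_def dcosh_def radicand_endpoint)
  have dcosh_pos: "0 < dcosh s" if "0 < s" for s
    unfolding dcosh_eq_square using that by simp
  have "((\<lambda>s. ?f (?g s) * ?g' s) has_integral Beta (1/6) (1/2)) {0..?L}"
  proof (rule has_integral_substitution_increasing[where f = ?f and g = ?g and g' = ?g'])
    show "0 \<le> ?L" using endpoint_pos by simp
    show "(?f has_integral Beta (1/6) (1/2)) {?g 0..?g ?L}"
      unfolding ends by (intro has_integral_Beta_real) auto
    show "0 \<le> ?f r" for r by simp
    show "(?g has_real_derivative ?g' s) (at s)" if "s \<in> {0..?L}" for s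
    proof (rule DERIV_chain2[where f = R])
      show "(R has_real_derivative R' (dcosh s)) (at (dcosh s))"
        unfolding R_def R'_def using signs(3)[of s] that by (intro iso_deriv) auto
      show "(dcosh has_real_derivative exp s - exp (- s)) (at s)"
        unfolding dcosh_def[abs_def] by (auto intro!: derivative_eq_intros)
    qed
    show "0 < ?g' s" if "s \<in> {0<..<?L}" for s
    proof -
      have "0 < iso_h (dcosh s) ^ 5 * iso_m (dcosh s)"
        using signs[of s] that by (intro mult_neg_neg) auto
      moreover have "R' (dcosh s)
          = 1875 * dcosh s ^ 2 * (iso_h (dcosh s) ^ 5 * iso_m (dcosh s)) / iso_n (dcosh s) ^ 4"
        by (simp add: R'_def mult_ac)
      ultimately have "0 < R' (dcosh s)"
        using signs[of s] dcosh_pos[of s] that by simp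
      then show ?thesis using that by (intro mult_pos_pos) auto
    qed
  qed
  then show ?thesis
  proof (rule has_integral_spike[of "{0, ?L}", rotated 2])
    fix s assume "s \<in> {0..?L} - {0, ?L}"
    then have s: "0 < s" "s < ?L" by auto
    define D h m n T where "D = dcosh s" and "h = - iso_h D" and "m = - iso_m D" and "n = iso_n D"
      and "T = radicand s"
    have pos: "D > 0" "h > 0" "m > 0" "n > 0" "T > 0"
      using s signs[of s] dcosh_pos[of s] radicand_pos[of s] unfolding D_def h_def m_def n_def T_def by auto
    define \<kappa> where "\<kappa> = sqrt 5 * exp ?L"
    have \<kappa>: "\<kappa> > 0" by (simp add: \<kappa>_def)
    have sqrt_power6: "sqrt y ^ 6 = y ^ 3" if "y > 0" for y
      using power_mult[of "sqrt y" 2 3] that by simp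
    have "\<kappa> ^ 6 = 5 ^ 3 * (exp (3 * ?L)) ^ 2"
      by (simp add: \<kappa>_def sqrt_power6 power_mult_distrib flip: exp_of_nat_mult)
    also have "\<dots> = 625 / 4" unfolding exp_3_endpoint by (simp add: power_divide)
    finally have \<kappa>6: "\<kappa> ^ 6 = 625 / 4" .
    define q where "q = \<kappa> * (sqrt D * h / sqrt n)"
    have q: "q > 0" using pos \<kappa> by (simp add: q_def)
    have "?g s = q ^ 6"
    proof -
      show ?thesis
        unfolding q_def power_mult_distrib power_divide \<kappa>6 sqrt_power6[OF pos(1)] sqrt_power6[OF pos(4)]
        by (simp add: R_def D_def h_def n_def)
    qed
    then have "?g s powr (1/6 - 1) = 1 / q ^ 5"
      using q by (simp add: powr_powr powr_minus divide_simps flip: powr_numeral)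
    moreover have "(1 - ?g s) powr (1/2 - 1) = n * sqrt n / (4 * m * sqrt T)"
    proof -
      have "n ^ 3 = n ^ 2 * n" by (simp add: power3_eq_cube power2_eq_square)
      then have "16 * T * m ^ 2 / n ^ 3 = (4 * m * sqrt T / (n * sqrt n)) ^ 2"
        using pos by (simp add: power_divide power_mult_distrib)
      then have "1 - ?g s = (4 * m * sqrt T / (n * sqrt n)) ^ 2"
        using one_minus_R[of s] s by (simp add: m_def n_def T_def D_def)
      then show ?thesis using pos by (simp add: powr_minus powr_half_sqrt real_sqrt_mult real_sqrt_divide)
    qed
    moreover have "R' D = 12 * \<kappa> ^ 6 * D ^ 2 * h ^ 5 * m / n ^ 4"
      unfolding R'_def \<kappa>6 by (simp add: h_def m_def n_def)
    moreover have "exp s - exp (- s) = sqrt D * (exp (s / 2) + exp (- (s / 2)))"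
    proof -
      have "sqrt D = exp (s / 2) - exp (- (s / 2))"
        unfolding D_def dcosh_eq_square using s by simp
      then show ?thesis by (simp only:) (simp add: algebra_simps flip: exp_add)
    qed
    ultimately have "?f (?g s) * ?g' s = 1 / q ^ 5 * (n * sqrt n / (4 * m * sqrt T)) *
        (12 * \<kappa> ^ 6 * D ^ 2 * h ^ 5 * m / n ^ 4 * (sqrt D * (exp (s / 2) + exp (- (s / 2)))))"
      unfolding D_def[symmetric] by simp
    also have "\<dots> = 3 * \<kappa> * ((exp (s / 2) + exp (- (s / 2))) / sqrt T)"
    proof -
      define d v where "d = sqrt D" and "v = sqrt n"
      have "d > 0" "v > 0" "D = d ^ 2" "n = v ^ 2" using pos by (auto simp: d_def v_def)
      then show ?thesis using pos \<kappa> unfolding q_def d_def[symmetric] v_def[symmetric]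
        by (simp add: field_simps eval_nat_numeral)
    qed
    finally show "sqrt 5 * (3 * exp ?L * ((exp (s / 2) + exp (- (s / 2))) / sqrt (radicand s)))
        = ?f (?g s) * ?g' s"
      by (simp add: \<kappa>_def T_def)
  qed auto
qed

lemma hyp2F1_of_real:
  fixes a b c x :: real
  assumes "summable (\<lambda>n. pochhammer a n * pochhammer b n / (pochhammer c n * pochhammer 1 n) * x ^ n)"
  shows "hyp2F1 (of_real a) (of_real b) (of_real c) (of_real x) = of_real
    (\<Sum>n. pochhammer a n * pochhammer b n / (pochhammer c n * pochhammer 1 n) * x ^ n)"
proof -
  have "pochhammer (1::complex) n = of_real (pochhammer 1 n)" for n
    using pochhammer_of_real[of 1 n, where 'a = complex] by simp
  then have "hyp2F1 (of_real a) (of_real b) (of_real c) (of_real x) = (\<Sum>n. of_real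
      (pochhammer a n * pochhammer b n / (pochhammer c n * pochhammer 1 n) * x ^ n))"
    unfolding hyp2F1_def by (simp add: pochhammer_of_real)
  then show ?thesis by (simp only: suminf_of_real[OF assms])
qed

theorem mainTheorem20:
  shows "hyp2F1 (1/3) (1/2) 1 (1/5) =
    complex_of_real (3 / 20 * (2 powr (2/3) * sqrt 5 * Gamma (1/3) ^ 3 / pi ^ 2))"
proof -
  define u :: "nat \<Rightarrow> real" where
    "u = (\<lambda>n. pochhammer (1/3) n * pochhammer (1/2) n / (pochhammer 1 n * pochhammer 1 n) * (1/5) ^ n)"
  have "summable u" unfolding u_def by (rule Euler_integral_2F1) auto
  from hyp2F1_of_real[OF this[unfolded u_def]]
  have hyp: "hyp2F1 (1/3) (1/2) 1 (1/5) = of_real (suminf u)" unfolding u_def by simp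
  have "((\<lambda>t. t powr (1/2 - 1) * (1 - t) powr (1 - 1/2 - 1) * (1 - 1/5 * t) powr (- (1/3)))
      has_integral Beta (1/2) (1 - 1/2) * suminf u) {0..1}"
    unfolding u_def by (rule Euler_integral_2F1) auto
  moreover have "Beta (1/2) (1/2 :: real) = pi" by (simp add: Beta_def Gamma_one_half_real)
  ultimately have "((\<lambda>t. t powr (-1/2) * (1 - t) powr (-1/2) * (1 - t / 5) powr (-1/3))
      has_integral pi * suminf u) {0..1}" by simp
  note has_integral_fold_even[OF has_integral_log_substitution[OF this]]
  then have "((\<lambda>s. 3 * exp endpoint * ((exp (s / 2) + exp (- (s / 2))) / sqrt (radicand s)))
      has_integral pi * suminf u) {0..endpoint}"
    using endpoint_pos by simp
  from has_integral_mult_right[OF this, of "sqrt 5"]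
  have "sqrt 5 * (pi * suminf u) = Beta (1/6) (1/2)"
    using has_integral_isogeny_substitution by (rule has_integral_unique)
  then have "suminf u = Beta (1/6) (1/2) / (sqrt 5 * pi)" by (simp add: field_simps)
  also have "\<dots> = sqrt 5 / 5 * Beta (1/6) (1/2) / pi" by (simp add: field_simps)
  also have "\<dots> = 3 / 20 * (2 powr (2/3) * sqrt 5 * Gamma (1/3) ^ 3 / pi ^ 2)"
    unfolding Beta_sixth_half by (simp add: power2_eq_square mult_ac)
  finally show ?thesis unfolding hyp by simp
qed

end
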